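(* For all integers $n\ge 1$, $$T_n(x,s,q)\,T_n(x,qs,q)-(x^2+qs)\,U_{n-1}(x,qs,q)\,U_{n-1}(x,q^2s,q)=q^{\binom{n+1}{2}}(-s)^n,$$ or equivalently $$T_n(qx,s,q)\,T_n(\sqrt q\,x,s,q)-q^{\frac{2n-1}{2}}(qx^2+s)\,U_{n-1}(x,s,q)\,U_{n-1}(\sqrt q\,x,s,q)=q^{\frac{n^2}{2}}(-s)^n.$$
   Context: Here $x,s,q$ are indeterminates; $\sqrt q$ is a fixed square root of $q$ and half-integer powers of $q$ are the corresponding powers of $\sqrt q$. Notation: $(a;q)_n=\prod_{j=0}^{n-1}(1-q^ja)$; $\begin{bmatrix} n\\k\end{bmatrix}=\frac{(q;q)_n}{(q;q)_k(q;q)_{n-k}}$ for $0\le k\le n$; $[n]=\frac{1-q^n}{1-q}$. The $q$-Chebyshev polynomials of the second kind are, for $n\ge0$, $$U_n(x,s,q)=\sum_{k=0}^{\lfloor n/2\rfloor}q^{k^2}\begin{bmatrix} n-k\\k\end{bmatrix}(1+q^{k+1})\cdots(1+q^{n-k})\,s^kx^{n-2k}.$$ The $q$-Chebyshev polynomials of the first kind are $T_0(x,s,q)=1$ and, for $n>0$, $$T_n(x,s,q)=\sum_{k=0}^{\lfloor n/2\rfloor}q^{k^2}\frac{[n]}{[n-k]}\begin{bmatrix} n-k\\k\end{bmatrix}\frac{(-q;q)_{n-1}}{(-q;q)_k\,(-q^{n-k};q)_k}\,s^kx^{n-2k}.$$ *)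

theory Defs
  imports
    "HOL-Computational_Algebra.Polynomial_Factorial"
begin

definition qpoch :: "'a::field \<Rightarrow> 'a \<Rightarrow> nat \<Rightarrow> 'a" where
  "qpoch a q n = (\<Prod>j<n. 1 - q ^ j * a)"

(* Only meaningful for k \<le> n; it is used below only in that range. *)
definition qbinom :: "nat \<Rightarrow> nat \<Rightarrow> 'a::field \<Rightarrow> 'a" where
  "qbinom n k q = qpoch q q n / (qpoch q q k * qpoch q q (n - k))"

definition qint :: "nat \<Rightarrow> 'a::field \<Rightarrow> 'a" where
  "qint n q = (1 - q ^ n) / (1 - q)"

definition cheb_U :: "nat \<Rightarrow> 'a::field \<Rightarrow> 'a \<Rightarrow> 'a \<Rightarrow> 'a" where
  "cheb_U n x s q =
     (\<Sum>k = 0..n div 2. q ^ (k\<^sup>2) * qbinom (n - k) k q *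
        (\<Prod>j = k + 1..n - k. 1 + q ^ j) * s ^ k * x ^ (n - 2 * k))"

definition cheb_T :: "nat \<Rightarrow> 'a::field \<Rightarrow> 'a \<Rightarrow> 'a \<Rightarrow> 'a" where
  "cheb_T n x s q =
     (if n = 0 then 1
      else \<Sum>k = 0..n div 2. q ^ (k\<^sup>2) * (qint n q / qint (n - k) q) * qbinom (n - k) k q *
        (qpoch (- q) q (n - 1) / (qpoch (- q) q k * qpoch (- (q ^ (n - k))) q k)) *
        s ^ k * x ^ (n - 2 * k))"

(* The rational function field in three indeterminates over 'k, realised as the fraction field
   of 'k[sqrt q][s][x]. The innermost variable is the square root of q, so that q itself is
   transcendental over 'k and half-integer powers of q are ordinary powers of sqrt_q. *)
type_synonym 'k ratfun = "'k poly poly poly fract"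

definition ind_sqrt_q :: "'k::field ratfun" where
  "ind_sqrt_q = to_fract [:[:[:0, 1:]:]:]"

definition ind_q :: "'k::field ratfun" where
  "ind_q = ind_sqrt_q ^ 2"

definition ind_s :: "'k::field ratfun" where
  "ind_s = to_fract [:[:0, 1:]:]"

definition ind_x :: "'k::field ratfun" where
  "ind_x = to_fract [:0, 1:]"

end

theory Submission
  imports Defs
begin

text \<open>
  The theorem is the \<open>q\<close>-analogue of Pell's equation \<open>T\<^sub>n\<^sup>2 - (x\<^sup>2 - 1) U\<^sub>n\<^sub>-\<^sub>1\<^sup>2 = 1\<close> for the
  classical Chebyshev polynomials (the case \<open>q = 1\<close>, \<open>s = -1\<close>).  Classically,
  \<open>(T\<^sub>n, U\<^sub>n\<^sub>-\<^sub>1)\<close> is obtained from its predecessor by the matrix with rows \<open>(x, x\<^sup>2 - 1)\<close> and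
  \<open>(1, x)\<close>, and the quadratic form is multiplied by the determinant \<open>1\<close>.  Here the form
  \<open>a b - W c d\<close> with \<open>W = x\<^sup>2 + q s\<close> is bilinear in two different pairs,
  \<open>(a, d) = (T\<^sub>n(x,s), U\<^sub>n\<^sub>-\<^sub>1(x,q\<^sup>2s))\<close> and \<open>(b, c) = (T\<^sub>n(x,qs), U\<^sub>n\<^sub>-\<^sub>1(x,qs))\<close>.  Each pair has
  its own first-order step,
  \<open>a' = q\<^sup>n x a + W d\<close>, \<open>d' = x d + q\<^sup>n a\<close> and \<open>b' = x b + q\<^sup>n W c\<close>, \<open>c' = q\<^sup>n x c + b\<close>.
  In \<open>a' b' - W c' d'\<close> the mixed products \<open>a c\<close> and \<open>b d\<close> cancel, and what remains is
  \<open>q\<^sup>n (x\<^sup>2 - W) (a b - W c d) = - q\<^sup>n\<^sup>+\<^sup>1 s (a b - W c d)\<close>.  At \<open>n = 1\<close> the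
  form is \<open>x\<^sup>2 - W = - q s\<close>, so at \<open>n\<close> it is \<open>q\<^bsup>1+2+...+n\<^esup> (-s)\<^sup>n\<close>.

  The four steps rest on three identities that hold coefficient by coefficient:
  the three-term recurrence \<open>cheb_U_rec\<close>, and the two expressions \<open>cheb_U_Suc_eq_T\<close> and
  \<open>cheb_U_shift_eq_T\<close> of \<open>T\<^sub>n\<close> through \<open>U\<^sub>n\<close> and \<open>U\<^sub>n\<^sub>-\<^sub>1\<close>, with the parameter \<open>s\<close> and \<open>q\<^sup>2s\<close>.
  They become one-line polynomial identities once \<open>(q;q)\<^sub>m (-q;q)\<^sub>m = (q\<^sup>2;q\<^sup>2)\<^sub>m\<close> has been used
  to put the coefficients of \<open>U\<^sub>n\<close> and \<open>T\<^sub>n\<close> over the same denominator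
  \<open>(q\<^sup>2;q\<^sup>2)\<^sub>k (q;q)\<^sub>n\<^sub>-\<^sub>2\<^sub>k\<close>.  All of this needs only that \<open>q\<close> is nonzero and no root of unity.

  The second form is the first one at \<open>s / q\<^sup>2\<close>, because both families are homogeneous when
  \<open>x\<close> has weight \<open>1\<close> and \<open>s\<close> has weight \<open>2\<close>.
\<close>

section \<open>Shifted factorials\<close>

lemma qpoch_0 [simp]: "qpoch a q 0 = 1"
  by (simp add: qpoch_def)

lemma qpoch_Suc: "qpoch a q (Suc n) = qpoch a q n * (1 - q ^ n * a)"
  by (simp add: qpoch_def)

lemma qpoch_add: "qpoch a q (m + n) = qpoch a q m * qpoch (a * q ^ m) q n"
  by (induction n) (simp_all add: qpoch_Suc power_add mult_ac)

lemma qpoch_base_square: "qpoch q q m * qpoch (- q) q m = qpoch (q\<^sup>2) (q\<^sup>2) m"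
proof (induction m)
  case (Suc m)
  have "qpoch q q (Suc m) * qpoch (- q) q (Suc m)
      = (qpoch q q m * qpoch (- q) q m) * ((1 - q ^ m * q) * (1 + q ^ m * q))"
    by (simp add: qpoch_Suc)
  also have "(1 - q ^ m * q) * (1 + q ^ m * q) = 1 - (q\<^sup>2) ^ m * q\<^sup>2"
    by (simp add: algebra_simps power_mult_distrib power2_eq_square)
  finally show ?case
    by (simp add: Suc.IH qpoch_Suc)
qed simp

lemma prod_one_plus_power:
  fixes q :: "'a::field"
  assumes "k \<le> m"
  shows "(\<Prod>j = k + 1..m. 1 + q ^ j) * qpoch (- q) q k = qpoch (- q) q m"
  using assms by (induction m rule: dec_induct) (simp_all add: qpoch_Suc mult_ac)

context
  fixes q :: "'a::field"
  assumes not_root_of_unity: "\<And>m. m > 0 \<Longrightarrow> q ^ m \<noteq> 1"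
begin

lemma one_minus_power_nonzero: "m > 0 \<Longrightarrow> 1 - q ^ m \<noteq> 0"
  using not_root_of_unity[of m] by auto

lemma qpoch_self_nonzero: "qpoch q q m \<noteq> 0"
proof (induction m)
  case (Suc m)
  then show ?case
    using one_minus_power_nonzero[of "Suc m"] by (simp add: qpoch_Suc mult.commute)
qed simp

lemma qpoch_square_nonzero: "qpoch (q\<^sup>2) (q\<^sup>2) m \<noteq> 0"
proof (induction m)
  case (Suc m)
  have "(q\<^sup>2) ^ m * q\<^sup>2 = q ^ (2 * Suc m)"
    by (simp only: power_mult power_Suc2)
  then show ?case
    using Suc one_minus_power_nonzero[of "2 * Suc m"] by (simp add: qpoch_Suc)
qed simp

lemma qpoch_neg_nonzero: "qpoch (- q) q m \<noteq> 0"
  using qpoch_square_nonzero[of m] by (auto simp flip: qpoch_base_square)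


section \<open>The coefficients over a common denominator\<close>

text \<open>Extending the coefficients by zero beyond \<open>k = n div 2\<close> allows sums for different \<open>n\<close> to
  be compared over one index range.\<close>

definition U_coeff :: "nat \<Rightarrow> nat \<Rightarrow> 'a" where
  "U_coeff n k = (if 2 * k \<le> n
     then q ^ k\<^sup>2 * qpoch (q\<^sup>2) (q\<^sup>2) (n - k) / (qpoch (q\<^sup>2) (q\<^sup>2) k * qpoch q q (n - 2 * k))
     else 0)"

definition T_coeff :: "nat \<Rightarrow> nat \<Rightarrow> 'a" where
  "T_coeff n k = (if 2 * k \<le> n
     then q ^ k\<^sup>2 * (1 - q ^ n) * qpoch (q\<^sup>2) (q\<^sup>2) (n - k - 1)
       / (qpoch (q\<^sup>2) (q\<^sup>2) k * qpoch q q (n - 2 * k))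
     else 0)"

lemma cheb_U_eq_sum:
  assumes "n \<le> N"
  shows "cheb_U n x s q = (\<Sum>k\<le>N. U_coeff n k * s ^ k * x ^ (n - 2 * k))"
proof -
  have coeff: "q ^ k\<^sup>2 * qbinom (n - k) k q * (\<Prod>j = k + 1..n - k. 1 + q ^ j) = U_coeff n k"
    if "k \<in> {0..n div 2}" for k
  proof -
    from that have le: "2 * k \<le> n" "k \<le> n - k" and sub: "n - k - k = n - 2 * k" by auto
    have "(\<Prod>j = k + 1..n - k. 1 + q ^ j) = qpoch (- q) q (n - k) / qpoch (- q) q k"
      using prod_one_plus_power[OF le(2), of q] qpoch_neg_nonzero[of k]
      by (simp add: field_simps)
    then show ?thesis
      unfolding qbinom_def sub using le by (simp add: U_coeff_def mult_ac flip: qpoch_base_square)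
  qed
  have "cheb_U n x s q = (\<Sum>k = 0..n div 2. U_coeff n k * s ^ k * x ^ (n - 2 * k))"
    unfolding cheb_U_def by (intro sum.cong refl) (simp only: coeff)
  also have "\<dots> = (\<Sum>k\<le>N. U_coeff n k * s ^ k * x ^ (n - 2 * k))"
    using assms by (intro sum.mono_neutral_left) (auto simp: U_coeff_def)
  finally show ?thesis .
qed

lemma cheb_T_eq_sum:
  assumes "n \<le> N" "n > 0"
  shows "cheb_T n x s q = (\<Sum>k\<le>N. T_coeff n k * s ^ k * x ^ (n - 2 * k))"
proof -
  have coeff: "q ^ k\<^sup>2 * (qint n q / qint (n - k) q) * qbinom (n - k) k q *
      (qpoch (- q) q (n - 1) / (qpoch (- q) q k * qpoch (- (q ^ (n - k))) q k)) = T_coeff n k"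
    if "k \<in> {0..n div 2}" for k
  proof -
    from that have le: "2 * k \<le> n" by auto
    define m where "m = n - k - 1"
    have m: "n - k = Suc m" "n - 1 = m + k" "n - k - k = n - 2 * k"
      using le assms(2) by (auto simp: m_def)
    \<comment> \<open>The quotient of shifted factorials is \<open>(-q;q)\<^sub>m\<close>, since
      \<open>(-q\<^bsup>n-k\<^esup>;q)\<^sub>k\<close> consists of the last \<open>k\<close> factors of \<open>(-q;q)\<^bsub>n-1\<^esub>\<close>.\<close>
    have "qpoch (- q) q (n - 1) = qpoch (- q) q m * qpoch (- (q ^ (n - k))) q k"
      unfolding m qpoch_add by (simp add: mult.commute)
    moreover from this have "qpoch (- (q ^ (n - k))) q k \<noteq> 0"
      using qpoch_neg_nonzero[of "n - 1"] by auto
    ultimately have quot: "qpoch (- q) q (n - 1) / (qpoch (- q) q k * qpoch (- (q ^ (n - k))) q k)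
        = qpoch (- q) q m / qpoch (- q) q k"
      by simp
    have "1 - q \<noteq> 0" "1 - q ^ Suc m \<noteq> 0"
      using one_minus_power_nonzero[of 1] one_minus_power_nonzero[of "Suc m"] by auto
    then have bracket: "qint n q / qint (n - k) q * qpoch q q (n - k) = (1 - q ^ n) * qpoch q q m"
      by (simp add: qint_def m(1) qpoch_Suc mult_ac)
    have "q ^ k\<^sup>2 * (qint n q / qint (n - k) q) * qbinom (n - k) k q *
          (qpoch (- q) q m / qpoch (- q) q k)
        = q ^ k\<^sup>2 * (qint n q / qint (n - k) q * qpoch q q (n - k)) * qpoch (- q) q m
          / ((qpoch q q k * qpoch (- q) q k) * qpoch q q (n - 2 * k))"
      unfolding qbinom_def m(3) by (simp add: mult_ac)
    also have "\<dots> = q ^ k\<^sup>2 * (1 - q ^ n) * (qpoch q q m * qpoch (- q) q m)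
          / ((qpoch q q k * qpoch (- q) q k) * qpoch q q (n - 2 * k))"
      unfolding bracket by (simp add: mult_ac)
    also have "\<dots> = T_coeff n k"
      unfolding qpoch_base_square using le by (simp add: T_coeff_def m_def)
    finally show ?thesis unfolding quot .
  qed
  have "cheb_T n x s q = (\<Sum>k = 0..n div 2. T_coeff n k * s ^ k * x ^ (n - 2 * k))"
    using assms(2) unfolding cheb_T_def by (simp only: coeff cong: sum.cong) simp
  also have "\<dots> = (\<Sum>k\<le>N. T_coeff n k * s ^ k * x ^ (n - 2 * k))"
    using assms(1) by (intro sum.mono_neutral_left) (auto simp: T_coeff_def)
  finally show ?thesis .
qed

text \<open>This is the coefficient of \<open>U\<^bsub>n+1\<^esub>\<close> without the last factor of its numerator.  All
  coefficients that meet at the same monomial in a linear relation for \<open>U\<^bsub>n+1\<^esub>\<close> are multiples of it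
  by a polynomial in \<open>q\<close>, so each such relation reduces to an identity between polynomials.\<close>

definition common_coeff :: "nat \<Rightarrow> nat \<Rightarrow> 'a" where
  "common_coeff n k = q ^ k\<^sup>2 * qpoch (q\<^sup>2) (q\<^sup>2) (n - k)
     / (qpoch (q\<^sup>2) (q\<^sup>2) k * qpoch q q (Suc n - 2 * k))"

lemma U_coeff_Suc_common:
  assumes "2 * k \<le> Suc n"
  shows "U_coeff (Suc n) k = (1 - q ^ (2 * (Suc n - k))) * common_coeff n k"
proof -
  have "Suc n - k = Suc (n - k)" using assms by auto
  moreover have "(q\<^sup>2) ^ (n - k) * q\<^sup>2 = q ^ (2 * Suc (n - k))"
    by (simp only: power_mult power_Suc2)
  ultimately show ?thesis
    using assms by (simp add: U_coeff_def common_coeff_def qpoch_Suc mult_ac)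
qed

text \<open>For \<open>2k = n + 1\<close> the factor \<open>1 - q\<^sup>0\<close> produces the zero outside the range.\<close>

lemma U_coeff_common:
  assumes "2 * k \<le> Suc n"
  shows "U_coeff n k = (1 - q ^ (Suc n - 2 * k)) * common_coeff n k"
proof (cases "2 * k \<le> n")
  case True
  then have eq: "Suc n - 2 * k = Suc (n - 2 * k)" by auto
  have "1 - q ^ Suc (n - 2 * k) \<noteq> 0"
    by (rule one_minus_power_nonzero) simp
  with True show ?thesis
    by (simp add: U_coeff_def common_coeff_def eq qpoch_Suc mult.commute[of _ q])
qed (use assms in \<open>simp add: U_coeff_def\<close>)

lemma T_coeff_Suc_common:
  assumes "2 * k \<le> Suc n"
  shows "T_coeff (Suc n) k = (1 - q ^ Suc n) * common_coeff n k"
  using assms by (simp add: T_coeff_def common_coeff_def mult_ac)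

text \<open>In the three-term recurrence the \<open>k\<close>-th term of \<open>U\<^sub>n\<close> is multiplied by \<open>s\<close>, so it meets the
  terms of index \<open>k + 1\<close> of \<open>U\<^bsub>n+1\<^esub>\<close> and \<open>U\<^bsub>n+2\<^esub>\<close>.\<close>

lemma U_coeff_prev_common:
  assumes "2 * Suc k \<le> Suc (Suc n)"
  shows "q ^ Suc n * U_coeff n k
    = q ^ (Suc (Suc n) - 2 * Suc k) * (1 - q ^ (2 * Suc k)) * common_coeff (Suc n) (Suc k)"
proof -
  obtain d where n: "n = 2 * k + d"
    using assms by (auto simp: le_iff_add)
  have "(q\<^sup>2) ^ k * q\<^sup>2 = q ^ (2 * Suc k)"
    by (simp only: power_mult power_Suc2)
  then have Q: "qpoch (q\<^sup>2) (q\<^sup>2) (Suc k) = qpoch (q\<^sup>2) (q\<^sup>2) k * (1 - q ^ (2 * Suc k))"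
    by (simp only: qpoch_Suc)
  have pow: "q ^ Suc n * q ^ k\<^sup>2 = q ^ d * q ^ (Suc k)\<^sup>2"
  proof -
    have "Suc n + k\<^sup>2 = d + (Suc k)\<^sup>2"
      by (simp add: n power2_eq_square)
    then show ?thesis
      by (simp only: flip: power_add)
  qed
  have nz: "1 - q ^ (2 * Suc k) \<noteq> 0"
    by (rule one_minus_power_nonzero) simp
  have "q ^ Suc n * U_coeff n k
      = (q ^ Suc n * q ^ k\<^sup>2) * qpoch (q\<^sup>2) (q\<^sup>2) (k + d) / (qpoch (q\<^sup>2) (q\<^sup>2) k * qpoch q q d)"
    by (simp add: U_coeff_def n mult_ac)
  also have "\<dots> = q ^ d * (1 - q ^ (2 * Suc k)) * common_coeff (Suc n) (Suc k)"
    unfolding pow common_coeff_def Q using nz by (simp add: n mult_ac)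
  finally show ?thesis by (simp add: n)
qed


section \<open>Linear relations between the two families\<close>

text \<open>Truncated subtraction makes the two exponents of \<open>x\<close> differ by something other than \<open>1\<close> when
  \<open>2k > n\<close>, but there the coefficient is zero.\<close>

lemma x_times_U_term:
  "x * (U_coeff n k * s ^ k * x ^ (n - 2 * k)) = U_coeff n k * s ^ k * x ^ (Suc n - 2 * k)"
  by (cases "2 * k \<le> n") (auto simp: U_coeff_def Suc_diff_le)

text \<open>After division by the common coefficient this is
  \<open>1 - q\<^bsup>2(n-k)\<^esup> = q\<^sup>n (1 - q\<^bsup>n-2k\<^esup>) + (1 - q\<^sup>n)\<close>, with \<open>n + 1\<close> in place of \<open>n\<close>.\<close>

lemma cheb_U_Suc_eq_T:
  "cheb_U (Suc n) x s q = q ^ Suc n * x * cheb_U n x s q + cheb_T (Suc n) x s q"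
proof -
  have coeff: "U_coeff (Suc n) k = q ^ Suc n * U_coeff n k + T_coeff (Suc n) k" for k
  proof (cases "2 * k \<le> Suc n")
    case True
    then have "Suc n + (Suc n - 2 * k) = 2 * (Suc n - k)"
      by simp
    then have "q ^ Suc n * q ^ (Suc n - 2 * k) = q ^ (2 * (Suc n - k))"
      by (simp only: flip: power_add)
    then have id: "1 - q ^ (2 * (Suc n - k))
        = q ^ Suc n * (1 - q ^ (Suc n - 2 * k)) + (1 - q ^ Suc n)"
      by (simp only: right_diff_distrib) simp
    show ?thesis
      unfolding U_coeff_Suc_common[OF True] U_coeff_common[OF True] T_coeff_Suc_common[OF True] id
      by (simp only: distrib_right mult.assoc)
  qed (simp add: U_coeff_def T_coeff_def)
  have "q ^ Suc n * x * cheb_U n x s q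
      = (\<Sum>k\<le>Suc n. q ^ Suc n * (x * (U_coeff n k * s ^ k * x ^ (n - 2 * k))))"
    by (simp only: cheb_U_eq_sum[of n "Suc n"] sum_distrib_left mult.assoc le_SucI order_refl)
  then show ?thesis
    unfolding x_times_U_term
    by (simp add: cheb_U_eq_sum[of "Suc n" "Suc n"] cheb_T_eq_sum[of "Suc n" "Suc n"] coeff
        algebra_simps sum.distrib del: power_Suc sum.atMost_Suc)
qed

text \<open>Replacing \<open>s\<close> by \<open>q\<^sup>2s\<close> multiplies the coefficient by \<open>q\<^bsup>2k\<^esup>\<close>, which moves the factor \<open>q\<^sup>n\<close>
  from \<open>U\<^sub>n\<^sub>-\<^sub>1\<close> to \<open>T\<^sub>n\<close>: now
  \<open>q\<^bsup>2k\<^esup> (1 - q\<^bsup>2(n-k)\<^esup>) = q\<^bsup>2k\<^esup> (1 - q\<^bsup>n-2k\<^esup>) + q\<^sup>n (1 - q\<^sup>n)\<close>, with \<open>n + 1\<close> in place of \<open>n\<close>.\<close>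

lemma cheb_U_shift_eq_T:
  "cheb_U (Suc n) x (q\<^sup>2 * s) q = x * cheb_U n x (q\<^sup>2 * s) q + q ^ Suc n * cheb_T (Suc n) x s q"
proof -
  have coeff: "U_coeff (Suc n) k * (q\<^sup>2 * s) ^ k
      = U_coeff n k * (q\<^sup>2 * s) ^ k + q ^ Suc n * T_coeff (Suc n) k * s ^ k" for k
  proof (cases "2 * k \<le> Suc n")
    case True
    have q2: "(q\<^sup>2 * s) ^ k = q ^ (2 * k) * s ^ k"
      by (simp add: power_mult_distrib power_mult)
    from True have "2 * k + 2 * (Suc n - k) = Suc n + Suc n" "2 * k + (Suc n - 2 * k) = Suc n"
      by simp_all
    then have p1: "q ^ (2 * k) * q ^ (2 * (Suc n - k)) = q ^ Suc n * q ^ Suc n"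
      and p2: "q ^ (2 * k) * q ^ (Suc n - 2 * k) = q ^ Suc n"
      by (simp_all only: flip: power_add)
    have "q ^ (2 * k) * (1 - q ^ (2 * (Suc n - k)))
        = q ^ (2 * k) * (1 - q ^ (Suc n - 2 * k)) + q ^ Suc n * (1 - q ^ Suc n)"
      by (simp only: right_diff_distrib p1 p2) (simp add: algebra_simps del: power_Suc)
    then have "q ^ (2 * k) * (1 - q ^ (2 * (Suc n - k))) * (common_coeff n k * s ^ k)
        = (q ^ (2 * k) * (1 - q ^ (Suc n - 2 * k)) + q ^ Suc n * (1 - q ^ Suc n))
          * (common_coeff n k * s ^ k)"
      by (rule arg_cong)
    then show ?thesis
      unfolding q2 U_coeff_Suc_common[OF True] U_coeff_common[OF True] T_coeff_Suc_common[OF True]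
      by (simp only: distrib_left distrib_right mult_ac)
  qed (simp add: U_coeff_def T_coeff_def)
  have "x * cheb_U n x (q\<^sup>2 * s) q
      = (\<Sum>k\<le>Suc n. x * (U_coeff n k * (q\<^sup>2 * s) ^ k * x ^ (n - 2 * k)))"
    by (simp only: cheb_U_eq_sum[of n "Suc n"] sum_distrib_left le_SucI order_refl)
  then show ?thesis
    unfolding x_times_U_term
    by (simp only: cheb_U_eq_sum[of "Suc n" "Suc n", OF order_refl]
        cheb_T_eq_sum[of "Suc n" "Suc n", OF order_refl zero_less_Suc] coeff
        sum_distrib_left distrib_right sum.distrib mult.assoc)
qed

text \<open>After division by the common coefficient this is
  \<open>1 - q\<^bsup>2(n-k)\<^esup> = (1 + q\<^sup>n) (1 - q\<^bsup>n-2k\<^esup>) + q\<^bsup>n-2k\<^esup> (1 - q\<^bsup>2k\<^esup>)\<close>, with \<open>n + 2\<close> in place of \<open>n\<close>;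
  at \<open>k = 0\<close> the last term vanishes, as the recurrence has no contribution there.\<close>

lemma cheb_U_rec:
  "cheb_U (Suc (Suc n)) x s q
    = (1 + q ^ Suc (Suc n)) * x * cheb_U (Suc n) x s q + q ^ Suc n * s * cheb_U n x s q"
proof -
  define N where "N = Suc (Suc n)"
  define prev where "prev k = (case k of 0 \<Rightarrow> 0 | Suc j \<Rightarrow> q ^ Suc n * U_coeff n j)" for k
  have prev: "prev k = q ^ (N - 2 * k) * (1 - q ^ (2 * k)) * common_coeff (Suc n) k"
    if "2 * k \<le> N" for k
  proof (cases k)
    case (Suc j)
    with that show ?thesis
      by (simp only: prev_def N_def nat.case U_coeff_prev_common)
  qed (simp add: prev_def)
  have coeff: "U_coeff N k = (1 + q ^ N) * U_coeff (Suc n) k + prev k" for k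
  proof (cases "2 * k \<le> N")
    case True
    from True have "N + (N - 2 * k) = 2 * (N - k)" "N - 2 * k + 2 * k = N"
      by simp_all
    then have p1: "q ^ N * q ^ (N - 2 * k) = q ^ (2 * (N - k))"
      and p2: "q ^ (N - 2 * k) * q ^ (2 * k) = q ^ N"
      by (simp_all only: flip: power_add)
    have id: "1 - q ^ (2 * (N - k))
        = (1 + q ^ N) * (1 - q ^ (N - 2 * k)) + q ^ (N - 2 * k) * (1 - q ^ (2 * k))"
      unfolding p1[symmetric] by (simp only: right_diff_distrib p2) (simp add: algebra_simps)
    show ?thesis
      unfolding prev[OF True] N_def U_coeff_Suc_common[OF True[unfolded N_def]]
        U_coeff_common[OF True[unfolded N_def]] id[unfolded N_def]
      by (simp only: distrib_right mult.assoc)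
  next
    case False
    then show ?thesis
      by (auto simp: U_coeff_def prev_def N_def split: nat.split)
  qed
  have "cheb_U N x s q
      = (\<Sum>k\<le>N. (1 + q ^ N) * (U_coeff (Suc n) k * s ^ k * x ^ (N - 2 * k)))
        + (\<Sum>k\<le>N. prev k * s ^ k * x ^ (N - 2 * k))"
    by (simp only: cheb_U_eq_sum[OF order_refl] coeff distrib_right sum.distrib mult.assoc)
  also have "(\<Sum>k\<le>N. (1 + q ^ N) * (U_coeff (Suc n) k * s ^ k * x ^ (N - 2 * k)))
      = (1 + q ^ N) * x * cheb_U (Suc n) x s q"
    unfolding N_def x_times_U_term[symmetric]
    by (simp only: cheb_U_eq_sum[of "Suc n" "Suc (Suc n)"] sum_distrib_left mult.assoc
        le_SucI order_refl)
  also have "(\<Sum>k\<le>N. prev k * s ^ k * x ^ (N - 2 * k)) = q ^ Suc n * s * cheb_U n x s q"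
    unfolding cheb_U_eq_sum[of n "Suc n", OF le_SucI[OF order_refl]]
    by (simp add: N_def sum.atMost_Suc_shift prev_def distrib_left sum_distrib_left mult_ac
        del: sum.atMost_Suc)
  finally show ?thesis by (simp only: N_def)
qed

lemma cheb_T_eq_U:
  "cheb_T (Suc (Suc n)) x s q = x * cheb_U (Suc n) x s q + q ^ Suc n * s * cheb_U n x s q"
  using cheb_U_rec[of n x s] cheb_U_Suc_eq_T[of "Suc n" x s]
  by (simp add: algebra_simps)

text \<open>Eliminating \<open>U\<^bsub>n+1\<^esub>\<close> from \<open>cheb_T_eq_U\<close> leaves \<open>U\<^sub>n\<close> with the coefficient
  \<open>x q\<^bsup>n+1\<^esup> x + q\<^bsup>n+1\<^esup> q s\<close>; this is where \<open>x\<^sup>2 + q s\<close> comes from.\<close>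

lemma cheb_T_step_same:
  "cheb_T (Suc (Suc n)) x (q * s) q
    = x * cheb_T (Suc n) x (q * s) q + q ^ Suc n * (x\<^sup>2 + q * s) * cheb_U n x (q * s) q"
  using cheb_T_eq_U[of n x "q * s"] cheb_U_Suc_eq_T[of n x "q * s"]
  by (simp add: algebra_simps power2_eq_square)

text \<open>The relation for the shifted parameter determines \<open>q\<^sup>n T\<^sub>n\<close> rather than \<open>T\<^sub>n\<close>; the recurrence for
  \<open>U\<^sub>n(x,q\<^sup>2s)\<close> supplies the power of \<open>q\<close> to be cancelled.\<close>

lemma cheb_T_step_shift:
  assumes "q \<noteq> 0"
  shows "cheb_T (Suc (Suc n)) x s q
    = q ^ Suc n * x * cheb_T (Suc n) x s q + (x\<^sup>2 + q * s) * cheb_U n x (q\<^sup>2 * s) q"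
proof -
  let ?U = "\<lambda>m. cheb_U m x (q\<^sup>2 * s) q"
  let ?p = "q ^ Suc (Suc n)"
  have "?p * cheb_T (Suc (Suc n)) x s q = ?U (Suc (Suc n)) - x * ?U (Suc n)"
    using cheb_U_shift_eq_T[of "Suc n" x s] by simp
  also have "\<dots> = ?p * (x * ?U (Suc n) + q * s * ?U n)"
    unfolding cheb_U_rec by (simp add: algebra_simps power2_eq_square)
  finally have "cheb_T (Suc (Suc n)) x s q = x * ?U (Suc n) + q * s * ?U n"
    using assms by simp
  then show ?thesis
    unfolding cheb_U_shift_eq_T by (simp add: algebra_simps power2_eq_square)
qed


section \<open>The Pell-type identity\<close>

lemma cheb_pell:
  assumes "q \<noteq> 0"
  shows "cheb_T (Suc n) x s q * cheb_T (Suc n) x (q * s) q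
      - (x\<^sup>2 + q * s) * cheb_U n x (q * s) q * cheb_U n x (q\<^sup>2 * s) q
    = q ^ (Suc (Suc n) choose 2) * (- s) ^ Suc n"
proof (induction n)
  case 0
  have "1 - q \<noteq> 0"
    using one_minus_power_nonzero[of 1] by simp
  then show ?case
    by (simp add: cheb_T_def cheb_U_def qint_def qbinom_def qpoch_Suc power2_eq_square
        numeral_2_eq_2)
next
  case (Suc n)
  define W where "W = x\<^sup>2 + q * s"
  define p where "p = q ^ Suc n"
  define a b c d where "a = cheb_T (Suc n) x s q" and "b = cheb_T (Suc n) x (q * s) q"
    and "c = cheb_U n x (q * s) q" and "d = cheb_U n x (q\<^sup>2 * s) q"
  have IH: "a * b - W * c * d = q ^ (Suc (Suc n) choose 2) * (- s) ^ Suc n"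
    using Suc.IH by (simp only: W_def a_def b_def c_def d_def)
  have "Suc (Suc (Suc n)) choose 2 = Suc (Suc n) + (Suc (Suc n) choose 2)"
    by (simp add: numeral_2_eq_2)
  then have pow: "q ^ (Suc (Suc (Suc n)) choose 2) = q * p * q ^ (Suc (Suc n) choose 2)"
    by (simp only: power_add p_def power_Suc)
  have "(p * x * a + W * d) * (x * b + p * W * c) - W * (p * x * c + b) * (x * d + p * a)
      = p * (x\<^sup>2 - W) * (a * b - W * c * d)"
    by (simp add: algebra_simps power2_eq_square)
  also have "\<dots> = p * (- (q * s)) * (q ^ (Suc (Suc n) choose 2) * (- s) ^ Suc n)"
    by (simp only: IH) (simp add: W_def)
  also have "\<dots> = q ^ (Suc (Suc (Suc n)) choose 2) * (- s) ^ Suc (Suc n)"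
    unfolding pow by simp
  finally show ?case
    unfolding cheb_T_step_same cheb_T_step_shift[OF assms, of n x s]
      cheb_U_shift_eq_T cheb_U_Suc_eq_T[of n x "q * s"]
    by (simp only: W_def p_def a_def b_def c_def d_def)
qed

end

lemma cheb_homogeneous:
  shows cheb_U_homogeneous: "cheb_U n (c * x) (c\<^sup>2 * s) q = c ^ n * cheb_U n x s q"
    and cheb_T_homogeneous: "cheb_T n (c * x) (c\<^sup>2 * s) q = c ^ n * cheb_T n x s q"
proof -
  have scale: "(c\<^sup>2 * s) ^ k * (c * x) ^ (n - 2 * k) = c ^ n * (s ^ k * x ^ (n - 2 * k))"
    if "k \<in> {0..n div 2}" for k
  proof -
    from that have "c ^ n = c ^ (2 * k) * c ^ (n - 2 * k)"
      by (simp flip: power_add)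
    moreover have "(c\<^sup>2 * s) ^ k = c ^ (2 * k) * s ^ k"
      by (simp add: power_mult_distrib power_mult)
    ultimately show ?thesis
      by (simp only: power_mult_distrib mult_ac)
  qed
  have sum: "(\<Sum>k = 0..n div 2. f k * (c\<^sup>2 * s) ^ k * (c * x) ^ (n - 2 * k))
      = c ^ n * (\<Sum>k = 0..n div 2. f k * s ^ k * x ^ (n - 2 * k))" for f
    unfolding sum_distrib_left
    by (intro sum.cong refl) (simp add: mult.assoc scale mult.left_commute)
  show "cheb_U n (c * x) (c\<^sup>2 * s) q = c ^ n * cheb_U n x s q"
    unfolding cheb_U_def by (rule sum)
  show "cheb_T n (c * x) (c\<^sup>2 * s) q = c ^ n * cheb_T n x s q"
    unfolding cheb_T_def by (cases "n = 0") (simp_all only: sum if_True if_False, simp)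
qed

text \<open>By homogeneity each factor on the left is a power of \<open>r = \<surd>q\<close> times a factor of the first
  form at \<open>t = s / q\<^sup>2\<close>; the powers total \<open>r\<^bsup>3(n+1)\<^esup>\<close> in both products.\<close>

lemma cheb_pell_sqrt:
  fixes r :: "'a::field"
  assumes nz: "r \<noteq> 0" and q: "q = r\<^sup>2"
    and not_root_of_unity: "\<And>m. m > 0 \<Longrightarrow> q ^ m \<noteq> 1"
  shows "cheb_T (Suc n) (q * x) s q * cheb_T (Suc n) (r * x) s q
      - r ^ (2 * n + 1) * (q * x\<^sup>2 + s) * cheb_U n x s q * cheb_U n (r * x) s q
    = r ^ (Suc n)\<^sup>2 * (- s) ^ Suc n"
proof -
  define t where "t = s / q\<^sup>2"
  have "q \<noteq> 0" using nz q by simp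
  then have s: "s = q\<^sup>2 * t" "s = r\<^sup>2 * (q * t)"
    by (simp_all add: t_def q power2_eq_square)
  have T1: "cheb_T (Suc n) (q * x) s q = r ^ (2 * Suc n) * cheb_T (Suc n) x t q"
    by (simp only: s(1) cheb_T_homogeneous q power_mult)
  have T2: "cheb_T (Suc n) (r * x) s q = r ^ Suc n * cheb_T (Suc n) x (q * t) q"
    by (simp only: s(2) cheb_T_homogeneous)
  have U: "cheb_U n (r * x) s q = r ^ n * cheb_U n x (q * t) q"
    by (simp only: s(2) cheb_U_homogeneous)
  have W: "q * x\<^sup>2 + s = r\<^sup>2 * (x\<^sup>2 + q * t)"
    by (simp add: s(1) q algebra_simps power2_eq_square)
  have exps: "r ^ (2 * Suc n) * r ^ Suc n = r ^ (3 * Suc n)"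
    "r ^ (2 * n + 1) * r\<^sup>2 * r ^ n = r ^ (3 * Suc n)"
    by (simp_all only: flip: power_add) (rule arg_cong[where f = "power r"], simp)+
  have "cheb_T (Suc n) (q * x) s q * cheb_T (Suc n) (r * x) s q
      - r ^ (2 * n + 1) * (q * x\<^sup>2 + s) * cheb_U n x s q * cheb_U n (r * x) s q
    = (r ^ (2 * Suc n) * r ^ Suc n) * (cheb_T (Suc n) x t q * cheb_T (Suc n) x (q * t) q)
      - (r ^ (2 * n + 1) * r\<^sup>2 * r ^ n)
        * ((x\<^sup>2 + q * t) * cheb_U n x (q * t) q * cheb_U n x (q\<^sup>2 * t) q)"
    unfolding T1 T2 U W s(1)[symmetric] by (simp only: mult_ac)
  also have "\<dots> = r ^ (3 * Suc n) * (cheb_T (Suc n) x t q * cheb_T (Suc n) x (q * t) q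
      - (x\<^sup>2 + q * t) * cheb_U n x (q * t) q * cheb_U n x (q\<^sup>2 * t) q)"
    unfolding exps by (simp only: right_diff_distrib)
  also have "cheb_T (Suc n) x t q * cheb_T (Suc n) x (q * t) q
      - (x\<^sup>2 + q * t) * cheb_U n x (q * t) q * cheb_U n x (q\<^sup>2 * t) q
    = q ^ (Suc (Suc n) choose 2) * (- t) ^ Suc n"
    using not_root_of_unity \<open>q \<noteq> 0\<close> by (rule cheb_pell)
  also have "r ^ (3 * Suc n) * (q ^ (Suc (Suc n) choose 2) * (- t) ^ Suc n)
      = r ^ (Suc n)\<^sup>2 * (- s) ^ Suc n"
  proof -
    have "2 * (Suc (Suc n) choose 2) = Suc (Suc n) * Suc n"
      by (simp add: choose_two)
    then have "3 * Suc n + 2 * (Suc (Suc n) choose 2) = (Suc n)\<^sup>2 + 4 * Suc n"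
      by (simp add: power2_eq_square)
    then have "r ^ (3 * Suc n) * q ^ (Suc (Suc n) choose 2) = r ^ (Suc n)\<^sup>2 * r ^ (4 * Suc n)"
      by (simp only: q flip: power_mult power_add)
    moreover have "r ^ (4 * Suc n) * (- t) ^ Suc n = (- s) ^ Suc n"
      by (simp only: s(1) q power_mult flip: power_mult_distrib) simp
    ultimately show ?thesis
      by (metis mult.assoc)
  qed
  finally show ?thesis .
qed


section \<open>The three indeterminates\<close>

lemma ind_sqrt_q_nonzero: "(ind_sqrt_q :: 'k::field ratfun) \<noteq> 0"
  by (simp add: ind_sqrt_q_def)

text \<open>A power of the innermost variable equal to \<open>1\<close> is refuted by setting all variables to \<open>0\<close>.\<close>

lemma ind_q_not_root_of_unity:
  assumes "m > 0"
  shows "(ind_q :: 'k::field ratfun) ^ m \<noteq> 1"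
proof
  assume "(ind_q :: 'k ratfun) ^ m = 1"
  moreover have "to_fract (p ^ i) = to_fract p ^ i" for p :: "'k poly poly poly" and i
    by (induction i) simp_all
  ultimately have "to_fract ([:[:[:0, 1 :: 'k:]:]:] ^ (2 * m)) = to_fract 1"
    by (simp add: ind_q_def ind_sqrt_q_def power_mult)
  then have "[:[:[:0, 1 :: 'k:]:]:] ^ (2 * m) = 1"
    by (simp only: to_fract_eq_iff)
  then have "poly (poly (poly ([:[:[:0, 1 :: 'k:]:]:] ^ (2 * m)) 0) 0) 0 = 1"
    by simp
  with assms show False
    by (simp add: poly_power power_0_left)
qed

theorem theorem5p6:
  fixes n :: nat
  assumes "n \<ge> 1"
  shows "let x = (ind_x :: 'k::field ratfun); s = ind_s; q = ind_q; sqrt_q = ind_sqrt_q in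
      cheb_T n x s q * cheb_T n x (q * s) q
        - (x ^ 2 + q * s) * cheb_U (n - 1) x (q * s) q * cheb_U (n - 1) x (q ^ 2 * s) q
        = q ^ ((n + 1) choose 2) * (- s) ^ n
    \<and> cheb_T n (q * x) s q * cheb_T n (sqrt_q * x) s q
        - sqrt_q ^ (2 * n - 1) * (q * x ^ 2 + s) *
            cheb_U (n - 1) x s q * cheb_U (n - 1) (sqrt_q * x) s q
        = sqrt_q ^ (n ^ 2) * (- s) ^ n"
proof -
  obtain m where n: "n = Suc m"
    using assms by (cases n) auto
  have idx: "n - 1 = m" "n + 1 = Suc (Suc m)" "2 * n - 1 = 2 * m + 1"
    by (simp_all add: n)
  have "(ind_q :: 'k ratfun) \<noteq> 0"
    by (simp add: ind_q_def ind_sqrt_q_nonzero)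
  note pell = cheb_pell[OF ind_q_not_root_of_unity this]
    and pell_sqrt = cheb_pell_sqrt[OF ind_sqrt_q_nonzero ind_q_def ind_q_not_root_of_unity]
  show ?thesis
    unfolding Let_def idx unfolding n by (intro conjI pell pell_sqrt)
qed

end
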